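(* Let $\mathcal{A}_G$ be the graphic arrangement in $\mathbb{K}^\ell$ defined by a simple graph $G$ with vertex set $[\ell]=\{1,\dots,\ell\}$. Then the set $$\{\gamma_F\mid F\neq\varnothing\text{ is a clique of }G\}$$ generates $\Omega^1(\mathcal{A}_G)$ as an $S$-module, where for a non-empty subset $F\subset[\ell]$, $$\gamma_F=\sum_{u\in F}\frac{dx_u}{\prod_{v\in F,\,v\ne u}(x_v-x_u)}.$$
   Context: Let $\mathbb{K}$ be a field, $V=\mathbb{K}^\ell$ and $S=\mathbb{K}[x_1,\dots,x_\ell]$, where $x_1,\dots,x_\ell$ are the coordinate functions. For a simple graph $G$ with vertex set $[\ell]$ and edge set $E(G)$, the graphic arrangement is $\mathcal{A}_G=\{\{x_u=x_v\}\mid\{u,v\}\in E(G)\}$. A subset $F\subset[\ell]$ is a clique of $G$ if $\{u,v\}\in E(G)$ for all distinct $u,v\in F$ (so every singleton is a clique); for $F=\{p\}$ one has $\gamma_{\{p\}}=dx_p$. For a finite set $\mathcal{A}$ of linear hyperplanes in $V$, $\alpha_H\in V^*$ denotes a defining linear form of $H\in\mathcal{A}$ and $Q(\mathcal{A})=\prod_{H\in\mathcal{A}}\alpha_H$. Let $\Omega_V^1=\bigoplus_i S\,dx_i$ be the free $S$-module on $dx_1,\dots,dx_\ell$, $\Omega_V^2=\bigwedge^2\Omega_V^1$, and for $\alpha=\sum c_ix_i$ let $d\alpha=\sum c_i\,dx_i$. The module of logarithmic differential $1$-forms is $$\Omega^1(\mathcal{A})=\{\omega\in \tfrac{1}{Q(\mathcal{A})}\Omega^1_V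 \mid Q(\mathcal{A})\,\omega\wedge d\alpha_H\in\alpha_H\Omega_V^2\ \text{for all } H\in\mathcal{A}\}.$$ *)

theory Defs
  imports
    "HOL-Analysis.Finite_Cartesian_Product"
    "HOL-Library.Poly_Mapping"
    "HOL-Computational_Algebra.Polynomial_Factorial"
begin

text \<open>
  The index type \<^typ>\<open>'n\<close> plays the role of the set of indices 1, ..., l, so that l is its
  cardinality and V is \<^typ>\<open>'k^'n\<close>. It is required to be linearly ordered only because the library
  derives the absence of zero divisors in S, needed to form the fraction field, from an order
  on the monomials.
\<close>

type_synonym ('n, 'k) mpoly = "('n \<Rightarrow>\<^sub>0 nat) \<Rightarrow>\<^sub>0 'k"

type_synonym ('n, 'k) ratfun = "('n, 'k) mpoly fract"

definition Const :: "'k \<Rightarrow> ('n, 'k::field) mpoly" where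
  "Const c = Poly_Mapping.single 0 c"

definition Var :: "'n \<Rightarrow> ('n, 'k::field) mpoly" where
  "Var i = Poly_Mapping.single (Poly_Mapping.single i 1) 1"


subsection \<open>Differential forms\<close>

text \<open>
  A rational 1-form is the vector of its coefficients with respect to the \<open>dx\<^sub>i\<close>. A rational 2-form
  is the alternating matrix whose \<open>(i, j)\<close> entry is, for \<open>i < j\<close>, its coefficient with respect to
  the basis element \<open>dx\<^sub>i \<and> dx\<^sub>j\<close>. The regular forms are those with coefficients in S.
\<close>

type_synonym ('n, 'k) form1 = "('n, 'k) ratfun ^ 'n"

type_synonym ('n, 'k) form2 = "('n, 'k) ratfun ^ 'n ^ 'n"

definition dx :: "'n \<Rightarrow> ('n::{finite,linorder}, 'k::field) form1" where
  "dx i = axis i 1"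

definition regular_forms1 :: "('n::{finite,linorder}, 'k::field) form1 set" where
  "regular_forms1 = {\<omega>. \<forall>i. \<omega> $ i \<in> range to_fract}"

definition regular_forms2 :: "('n::{finite,linorder}, 'k::field) form2 set" where
  "regular_forms2 =
    {\<theta>. (\<forall>i j. \<theta> $ i $ j \<in> range to_fract) \<and>
        (\<forall>i. \<theta> $ i $ i = 0) \<and> (\<forall>i j. \<theta> $ j $ i = - \<theta> $ i $ j)}"

definition wedge :: "('n::{finite,linorder}, 'k::field) form1 \<Rightarrow> ('n, 'k) form1 \<Rightarrow> ('n, 'k) form2"
  where "wedge \<omega> \<eta> = (\<chi> i j. \<omega> $ i * \<eta> $ j - \<omega> $ j * \<eta> $ i)"

definition scale2 :: "('n::{finite,linorder}, 'k::field) ratfun \<Rightarrow> ('n, 'k) form2 \<Rightarrow> ('n, 'k) form2"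
  where "scale2 f \<theta> = (\<chi> i j. f * \<theta> $ i $ j)"

definition poly_scale :: "('n::{finite,linorder}, 'k::field) mpoly \<Rightarrow> ('n, 'k) form1 \<Rightarrow> ('n, 'k) form1"
  where "poly_scale p \<omega> = to_fract p *s \<omega>"

lemma module_poly_scale:
  "module (poly_scale :: ('n::{finite,linorder}, 'k::field) mpoly \<Rightarrow> _)"
  by unfold_locales
    (simp_all add: poly_scale_def vec_eq_iff algebra_simps)


subsection \<open>Logarithmic forms of an arrangement\<close>

text \<open>A linear form \<open>\<Sum>i. c\<^sub>i x\<^sub>i\<close> is given by its coefficient vector \<open>c\<close>.\<close>

definition is_defining_form :: "('k::field ^ 'n::finite) \<Rightarrow> ('k ^ 'n) set \<Rightarrow> bool" where
  "is_defining_form c H \<longleftrightarrow> c \<noteq> 0 \<and> H = {x. (\<Sum>i\<in>UNIV. c $ i * x $ i) = 0}"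

definition linear_poly :: "('k::field ^ 'n::finite) \<Rightarrow> ('n, 'k) mpoly" where
  "linear_poly c = (\<Sum>i\<in>UNIV. Const (c $ i) * Var i)"

definition d_linear :: "('k::field ^ 'n::{finite,linorder}) \<Rightarrow> ('n, 'k) form1" where
  "d_linear c = (\<Sum>i\<in>UNIV. to_fract (Const (c $ i)) *s dx i)"

text \<open>
  A defining form of a hyperplane is unique up to a nonzero scalar, so the choice made here does
  not affect the module of logarithmic forms.
\<close>

definition form_of :: "('k::field ^ 'n::finite) set \<Rightarrow> 'k ^ 'n" where
  "form_of H = (SOME c. is_defining_form c H)"

definition defining_poly ::
    "('k::field ^ 'n::{finite,linorder}) set set \<Rightarrow> ('n, 'k) mpoly" where
  "defining_poly A = (\<Prod>H\<in>A. linear_poly (form_of H))"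

definition log_forms1 ::
    "('k::field ^ 'n::{finite,linorder}) set set \<Rightarrow> ('n, 'k) form1 set" where
  "log_forms1 A =
    {\<omega>. (\<exists>\<eta>\<in>regular_forms1. \<omega> = (1 / to_fract (defining_poly A)) *s \<eta>) \<and>
        (\<forall>H\<in>A. \<exists>\<theta>\<in>regular_forms2.
          wedge (to_fract (defining_poly A) *s \<omega>) (d_linear (form_of H)) =
          scale2 (to_fract (linear_poly (form_of H))) \<theta>)}"


subsection \<open>Graphic arrangements\<close>

text \<open>A simple graph with vertex set \<^term>\<open>UNIV :: 'n set\<close> is given by its set of edges.\<close>

definition simple_graph :: "'n set set \<Rightarrow> bool" where
  "simple_graph E \<longleftrightarrow> (\<forall>e\<in>E. card e = 2)"

definition clique :: "'n set set \<Rightarrow> 'n set \<Rightarrow> bool" where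
  "clique E F \<longleftrightarrow> (\<forall>u\<in>F. \<forall>v\<in>F. u \<noteq> v \<longrightarrow> {u, v} \<in> E)"

definition graphic_arrangement :: "'n::finite set set \<Rightarrow> ('k::field ^ 'n) set set" where
  "graphic_arrangement E = {{x. x $ u = x $ v} | u v. {u, v} \<in> E}"

definition clique_form :: "'n set \<Rightarrow> ('n::{finite,linorder}, 'k::field) form1" where
  "clique_form F = (\<Sum>u\<in>F. (1 / (\<Prod>v\<in>F - {u}. to_fract (Var v - Var u))) *s dx u)"

end

theory Submission
  imports Defs
begin

text \<open>
  Let \<open>P\<^sub>i\<close> be the product of the \<open>x\<^sub>w - x\<^sub>i\<close> over the neighbours \<open>w\<close> of \<open>i\<close>. A logarithmic form is
  \<open>\<Sum>\<^sub>i (f\<^sub>i / P\<^sub>i) dx\<^sub>i\<close> with polynomials \<open>f\<^sub>i\<close> such that, for every edge \<open>uv\<close>, the sum of the coefficients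
  of \<open>dx\<^sub>u\<close> and \<open>dx\<^sub>v\<close> has no pole along \<open>x\<^sub>u = x\<^sub>v\<close>. Fix a vertex \<open>l\<close>. If \<open>a\<close> and \<open>b\<close> are
  non-adjacent neighbours of \<open>l\<close>, the condition at the edge \<open>al\<close> puts \<open>f\<^sub>l\<close> in the prime ideal
  \<open>(x\<^sub>a - x\<^sub>l, x\<^sub>b - x\<^sub>l)\<close>. The intersection of these primes is generated by the products of the
  \<open>x\<^sub>w - x\<^sub>l\<close> over the complements, in the neighbourhood of \<open>l\<close>, of its cliques \<open>F\<close>; the product
  belonging to \<open>F\<close> is the value of \<open>f\<^sub>l\<close> for the form of the clique \<open>F \<union> {l}\<close>. So
  subtracting a combination of clique forms makes \<open>f\<^sub>l\<close> vanish; the remaining form then has no pole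
  along the hyperplanes \<open>x\<^sub>u = x\<^sub>l\<close>, and one continues with the graph without \<open>l\<close>.
\<close>

subsection \<open>Substitution in polynomials\<close>

lemma Const_0 [simp]: "Const 0 = 0"
  by (simp add: Const_def)

lemma Const_1 [simp]: "Const 1 = 1"
  by (simp add: Const_def)

lemma Const_add: "Const (a + b) = Const a + Const b"
  by (simp add: Const_def single_add)

lemma Const_mult: "Const (a * b) = Const a * Const b"
  by (simp add: Const_def mult_single)

lemma Const_uminus: "Const (- a) = - Const a"
  by (simp add: Const_def single_uminus)

lemma Var_eq_iff [simp]: "(Var i :: ('n, 'k::field) mpoly) = Var j \<longleftrightarrow> i = j"
proof
  assume "(Var i :: ('n, 'k) mpoly) = Var j"
  then have "Poly_Mapping.keys (Var i :: ('n, 'k) mpoly) = Poly_Mapping.keys (Var j :: ('n, 'k) mpoly)"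
    by simp
  then have "Poly_Mapping.single i (1::nat) = Poly_Mapping.single j 1"
    by (simp add: Var_def)
  then have "Poly_Mapping.keys (Poly_Mapping.single i (1::nat)) =
      Poly_Mapping.keys (Poly_Mapping.single j (1::nat))"
    by simp
  then show "i = j"
    by simp
qed simp

lemma Var_power: "(Var i :: ('n, 'k::field) mpoly) ^ k =
    Poly_Mapping.single (Poly_Mapping.single i k) 1"
  by (induction k) (simp_all add: Var_def mult_single single_add[symmetric])

lemma prod_single_1: "finite A \<Longrightarrow> (\<Prod>i\<in>A. Poly_Mapping.single (m i) (1::'k::field)) =
    Poly_Mapping.single (\<Sum>i\<in>A. m i) 1"
  by (induction A rule: finite_induct) (simp_all add: mult_single)

lemma single_conv_Var:
  "Poly_Mapping.single m c =
    (Const c * (\<Prod>i\<in>UNIV. Var i ^ Poly_Mapping.lookup m i) :: ('n::finite, 'k::field) mpoly)"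
proof -
  have "(\<Sum>i\<in>UNIV. Poly_Mapping.single i (Poly_Mapping.lookup m i)) = m"
    by (rule poly_mapping_eqI) (simp add: lookup_sum lookup_single when_def)
  then show ?thesis
    by (simp add: Var_power prod_single_1 Const_def mult_single)
qed

section \<open>Induction over terms and over ring generators\<close>

lemma mpoly_single_induct [case_names single add]:
  fixes p :: "('n, 'k::field) mpoly"
  assumes "\<And>m c. P (Poly_Mapping.single m c)"
    and "\<And>p q. P p \<Longrightarrow> P q \<Longrightarrow> P (p + q)"
  shows "P p"
proof (induction p rule: update_induct)
  case const
  show ?case
    using assms(1)[of 0 0] by simp
next
  case (update f a b)
  have "Poly_Mapping.update a b f = f + Poly_Mapping.single a b"
    using update by (intro poly_mapping_eqI)
      (auto simp: lookup_update lookup_add lookup_single when_def not_in_keys_iff_lookup_eq_zero)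
  then show ?case
    using update assms by simp
qed

text \<open>Constants and variables generate the polynomial ring, so a property preserved by sums
  and products need only be checked on them.\<close>

lemma mpoly_induct [case_names Const Var add mult]:
  fixes p :: "('n::finite, 'k::field) mpoly"
  assumes const: "\<And>c. P (Const c)" and var: "\<And>i. P (Var i)"
    and add: "\<And>p q. P p \<Longrightarrow> P q \<Longrightarrow> P (p + q)"
    and mult: "\<And>p q. P p \<Longrightarrow> P q \<Longrightarrow> P (p * q)"
  shows "P p"
proof (induction p rule: mpoly_single_induct)
  case (single m c)
  have pow: "P (Var i ^ k)" for i k
    using const[of 1] by (induction k) (simp_all add: var mult)
  have "P (\<Prod>i\<in>A. Var i ^ Poly_Mapping.lookup m i)" if "finite A" for A
    using that const[of 1] by (induction A rule: finite_induct) (simp_all add: mult pow)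
  then show ?case
    by (simp add: single_conv_Var const mult)
qed (fact add)

text \<open>The endomorphism of the polynomial algebra over the field \<open>'k\<close> that takes
  the value \<open>s i\<close> at \<open>Var i\<close>.\<close>

definition substitute ::
    "('n \<Rightarrow> ('n, 'k) mpoly) \<Rightarrow> ('n::finite, 'k::field) mpoly \<Rightarrow> ('n, 'k) mpoly" where
  "substitute s p = (\<Sum>m\<in>Poly_Mapping.keys p. Const (Poly_Mapping.lookup p m) *
    (\<Prod>i\<in>UNIV. s i ^ Poly_Mapping.lookup m i))"

lemma substitute_single: "substitute s (Poly_Mapping.single m c) =
    Const c * (\<Prod>i\<in>UNIV. s i ^ Poly_Mapping.lookup m i)"
  by (cases "c = 0") (simp_all add: substitute_def)

lemma substitute_add: "substitute s (p + q) = substitute s p + substitute s q"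
  unfolding substitute_def
  by (rule setsum_keys_plus_distrib) (simp_all add: Const_add distrib_right)

lemma substitute_0 [simp]: "substitute s 0 = 0"
  by (simp add: substitute_def)

lemma substitute_Const [simp]: "substitute s (Const c) = Const c"
  by (simp add: Const_def substitute_single)

lemma substitute_1 [simp]: "substitute s 1 = 1"
  using substitute_Const[of s 1] by simp

lemma substitute_Var [simp]: "substitute s (Var i) = s i"
proof -
  have "(\<Prod>j\<in>UNIV. s j ^ (if i = j then Suc 0 else 0)) = s i"
    by (simp add: if_distrib[of "power _"] cong: if_cong)
  then show ?thesis
    by (simp add: Var_def substitute_single lookup_single when_def)
qed

text \<open>Both sides are additive in each argument, which leaves products of two single terms,
  where exponents add.\<close>

lemma substitute_mult: "substitute s (p * q) = substitute s p * substitute s q"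
proof (induction p rule: mpoly_single_induct)
  case (single m c)
  show ?case
  proof (induction q rule: mpoly_single_induct)
    case (single n d)
    show ?case
      by (simp add: mult_single substitute_single Const_mult lookup_add power_add
          prod.distrib algebra_simps)
  qed (simp add: substitute_add algebra_simps)
qed (simp add: substitute_add algebra_simps)

lemma substitute_uminus: "substitute s (- p) = - substitute s p"
  using substitute_add[of s p "- p"] by (simp add: eq_neg_iff_add_eq_0 add.commute)

lemma substitute_diff: "substitute s (p - q) = substitute s p - substitute s q"
  using substitute_add[of s p "- q"] by (simp add: substitute_uminus)

lemma substitute_prod: "substitute s (\<Prod>i\<in>A. f i) = (\<Prod>i\<in>A. substitute s (f i))"
  by (induction A rule: infinite_finite_induct) (simp_all add: substitute_mult)

lemmas substitute_hom =
  substitute_add substitute_mult substitute_uminus substitute_diff substitute_prod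

lemma substitute_substitute: "substitute s (substitute t p) = substitute (\<lambda>i. substitute s (t i)) p"
  by (induction p rule: mpoly_induct) (simp_all add: substitute_hom)

section \<open>Identification of variables and divisibility by their differences\<close>

definition collapse :: "'n set \<Rightarrow> 'n \<Rightarrow> ('n::finite, 'k::field) mpoly \<Rightarrow> ('n, 'k) mpoly" where
  "collapse A l = substitute (\<lambda>i. Var (if i \<in> A then l else i))"

lemma collapse_hom:
  "collapse A l (p + q) = collapse A l p + collapse A l q"
  "collapse A l (p * q) = collapse A l p * collapse A l q"
  "collapse A l (- p) = - collapse A l p"
  "collapse A l (p - q) = collapse A l p - collapse A l q"
  "collapse A l (\<Prod>i\<in>B. f i) = (\<Prod>i\<in>B. collapse A l (f i))"
  by (simp_all add: collapse_def substitute_hom)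

lemma collapse_0 [simp]: "collapse A l 0 = 0"
  by (simp add: collapse_def)

lemma collapse_1 [simp]: "collapse A l 1 = 1"
  by (simp add: collapse_def)

lemma collapse_Const [simp]: "collapse A l (Const c) = Const c"
  by (simp add: collapse_def)

lemma collapse_Var [simp]: "collapse A l (Var i) = Var (if i \<in> A then l else i)"
  by (simp add: collapse_def)

text \<open>The common target \<open>l\<close> is fixed by both maps, so they compose to one map and
  commute.\<close>

lemma collapse_collapse: "collapse A l (collapse B l p) = collapse (A \<union> B) l p"
  unfolding collapse_def substitute_substitute
  by (rule arg_cong[of _ _ "\<lambda>s. substitute s p"]) (auto simp: fun_eq_iff)

text \<open>Congruence modulo \<open>Var u - Var v\<close> passes to sums and products, so only
  constants and variables need a check.\<close>

lemma dvd_diff_collapse: "(Var u - Var v) dvd p - collapse {u} v p"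
proof (induction p rule: mpoly_induct)
  case (mult p q)
  have "p * q - collapse {u} v (p * q) =
      (p - collapse {u} v p) * q + collapse {u} v p * (q - collapse {u} v q)"
    by (simp add: collapse_hom algebra_simps)
  then show ?case
    using mult by simp
next
  case (add p q)
  have "p + q - collapse {u} v (p + q) = (p - collapse {u} v p) + (q - collapse {u} v q)"
    by (simp add: collapse_hom)
  then show ?case
    using add dvd_add by metis
qed simp_all

text \<open>\<open>collapse {u} v\<close> models reduction modulo \<open>Var u - Var v\<close>
  inside the same ring; divisibility thus becomes the vanishing of a ring homomorphism.\<close>

lemma dvd_iff_collapse: "(Var u - Var v) dvd p \<longleftrightarrow> collapse {u} v p = 0"
proof
  assume "(Var u - Var v) dvd p"
  then show "collapse {u} v p = 0"
    by (auto elim!: dvdE simp: collapse_hom)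
next
  assume "collapse {u} v p = 0"
  then show "(Var u - Var v) dvd p"
    using dvd_diff_collapse[of u v p] by simp
qed

lemma dvd_diff_iff_collapse_eq:
  "(Var u - Var v) dvd p - q \<longleftrightarrow> collapse {u} v p = collapse {u} v q"
  by (simp add: dvd_iff_collapse collapse_hom)

text \<open>The kernel of a homomorphism into an integral domain is a prime ideal.\<close>

lemma prime_elem_Var_diff:
  assumes "u \<noteq> v"
  shows "prime_elem (Var u - Var v :: ('n::{finite,linorder}, 'k::field) mpoly)"
proof (rule prime_elemI)
  have "collapse {u} v (1 :: ('n, 'k) mpoly) \<noteq> 0"
    by simp
  then show "\<not> (Var u - Var v) dvd (1 :: ('n, 'k) mpoly)"
    unfolding dvd_iff_collapse .
qed (use assms in \<open>simp_all add: dvd_iff_collapse collapse_hom\<close>)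

lemma Var_diff_dvd_Var_diff_iff:
  assumes "u \<noteq> v"
  shows "(Var u - Var v :: ('n::finite, 'k::field) mpoly) dvd Var a - Var b \<longleftrightarrow>
    a = b \<or> {a, b} = {u, v}"
  using assms by (auto simp: dvd_iff_collapse collapse_hom doubleton_eq_iff split: if_splits)

subsection \<open>The ideal of complements of cliques\<close>

text \<open>Once one prime is divided out, the cofactor is still divisible by the others, since none
  of them divides the removed one.\<close>

lemma prod_prime_elem_dvd:
  fixes x :: "'a::idom"
  assumes "finite A" and "\<And>a. a \<in> A \<Longrightarrow> prime_elem (p a)"
    and "\<And>a b. a \<in> A \<Longrightarrow> b \<in> A \<Longrightarrow> a \<noteq> b \<Longrightarrow> \<not> p a dvd p b"
    and "\<And>a. a \<in> A \<Longrightarrow> p a dvd x"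
  shows "(\<Prod>a\<in>A. p a) dvd x"
  using assms
proof (induction A arbitrary: x rule: finite_induct)
  case (insert a A)
  from insert.prems(3)[of a] obtain y where y: "x = p a * y"
    by (auto elim: dvdE)
  have "p b dvd y" if "b \<in> A" for b
  proof -
    have "p b dvd p a * y" and "prime_elem (p b)" and "\<not> p b dvd p a"
      using insert.prems insert.hyps that y by auto
    then show ?thesis
      by (simp add: prime_elem_dvd_mult_iff)
  qed
  then have "(\<Prod>a\<in>A. p a) dvd y"
    using insert by blast
  then show ?case
    using insert.hyps y by simp
qed simp

lemma clique_insert:
  assumes "clique E F" and "\<And>w. w \<in> F \<Longrightarrow> {v, w} \<in> E"
  shows "clique E (insert v F)"
  using assms by (auto simp: clique_def insert_commute)

text \<open>
  The products below are the squarefree monomials in the variables \<open>x\<^sub>w - x\<^sub>l\<close> that generate the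
  Stanley-Reisner ideal of the Alexander dual of the clique complex on \<open>N\<close>. Since the minimal
  nonfaces of a clique complex are the non-edges, this ideal is the intersection of the primes
  \<open>(x\<^sub>a - x\<^sub>l, x\<^sub>b - x\<^sub>l)\<close>, with \<open>ab\<close> a non-edge, that are the kernels of the maps \<open>collapse {a, b} l\<close>.
\<close>

lemma clique_complement_ideal:
  fixes f :: "('n::{finite,linorder}, 'k::field) mpoly"
  assumes "l \<notin> N"
    and "\<And>a b. a \<in> N \<Longrightarrow> b \<in> N \<Longrightarrow> a \<noteq> b \<Longrightarrow> {a, b} \<notin> E \<Longrightarrow> collapse {a, b} l f = 0"
    and "\<And>p q. p \<in> I \<Longrightarrow> q \<in> I \<Longrightarrow> p + q \<in> I"
    and "\<And>p r. p \<in> I \<Longrightarrow> r * p \<in> I"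
    and "\<And>F. F \<subseteq> N \<Longrightarrow> clique E F \<Longrightarrow> (\<Prod>w\<in>N - F. Var w - Var l) \<in> I"
  shows "f \<in> I"
  using finite[of N] assms
proof (induction N arbitrary: f I rule: finite_psubset_induct)
  case (psubset N)
  note add = psubset.prems(3) and scale = psubset.prems(4) and gen = psubset.prems(5)
  show ?case
  proof (cases "N = {}")
    case True
    \<comment> \<open>The product belonging to the empty clique is the empty product 1, so
      \<open>I\<close> is the whole ring.\<close>
    then show ?thesis
      using scale[of 1 f] gen[of "{}"] by (simp add: clique_def)
  next
    case False
    then obtain v where v: "v \<in> N"
      by blast
    define y :: "'n \<Rightarrow> ('n, 'k) mpoly" where "y w = Var w - Var l" for w
    \<comment> \<open>The splitting \<open>f = y v * h + f'\<close>, where \<open>f'\<close> is the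
      value of \<open>f\<close> at \<open>y v = 0\<close>. Induction on \<open>N - {v}\<close>
      handles \<open>h\<close>; for \<open>f'\<close>, the factors \<open>y w\<close> of the
      non-neighbours \<open>w\<close> in \<open>W\<close> are divided out and induction on the
      neighbours \<open>M\<close> handles the cofactor.\<close>
    define f' where "f' = collapse {v} l f"
    define W where "W = {w \<in> N - {v}. {v, w} \<notin> E}"
    define M where "M = {w \<in> N - {v}. {v, w} \<in> E}"
    have y_nz: "y w \<noteq> 0" if "w \<in> N" for w
      using that psubset.prems(1) by (auto simp: y_def)
    have collapse_y: "collapse A l (y w) = y w" if "w \<notin> A" for w A
      using that by (simp add: y_def collapse_hom)
    have f'0: "collapse {a, b} l f' = 0"
      if "a \<in> N" "b \<in> N" "a \<noteq> b" "{a, b} \<notin> E" for a b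
    proof -
      have "collapse {a, b} l f' = collapse {v} l (collapse {a, b} l f)"
        by (simp add: f'_def collapse_collapse Un_commute insert_commute)
      then show ?thesis
        using psubset.prems(2) that by simp
    qed
    obtain h where h: "f - f' = y v * h"
      using dvd_diff_collapse[of v l f] by (auto simp: y_def f'_def elim: dvdE)
    \<comment> \<open>The induction hypothesis is applied to the ideal quotient of \<open>I\<close>
      by \<open>y v\<close>: a clique avoiding \<open>v\<close> has \<open>v\<close> in its
      complement, so its product contains the factor \<open>y v\<close>.\<close>
    have "h \<in> {h. y v * h \<in> I}"
    proof (rule psubset.IH[of "N - {v}"])
      show "collapse {a, b} l h = 0"
        if "a \<in> N - {v}" "b \<in> N - {v}" "a \<noteq> b" "{a, b} \<notin> E" for a b
      proof -
        \<comment> \<open>Since \<open>v\<close> is neither \<open>a\<close> nor \<open>b\<close>,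
          the map fixes \<open>y v\<close>, which can then be cancelled.\<close>
        have "y v * collapse {a, b} l h = collapse {a, b} l (f - f')"
          using that collapse_y[of v "{a, b}"] by (auto simp: h collapse_hom(2))
        also have "\<dots> = 0"
          using that f'0 psubset.prems(2) by (simp add: collapse_hom)
        finally show ?thesis
          using y_nz v by simp
      qed
      show "(\<Prod>w\<in>N - {v} - F. Var w - Var l) \<in> {h. y v * h \<in> I}"
        if "F \<subseteq> N - {v}" "clique E F" for F
      proof -
        have "N - F = insert v (N - {v} - F)"
          using v that by auto
        then have "(\<Prod>w\<in>N - F. y w) = y v * (\<Prod>w\<in>N - {v} - F. y w)"
          by simp
        then show ?thesis
          using gen[of F] that by (auto simp: y_def)
      qed
    next
      show "p + q \<in> {h. y v * h \<in> I}" if "p \<in> {h. y v * h \<in> I}" "q \<in> {h. y v * h \<in> I}" for p q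
        using that add by (simp add: distrib_left)
      show "r * p \<in> {h. y v * h \<in> I}" if "p \<in> {h. y v * h \<in> I}" for p r
        using that scale[of "y v * p" r] by (simp add: mult.left_commute)
    qed (use v psubset.prems(1) in auto)
    moreover have "f' \<in> I"
    proof -
      \<comment> \<open>Setting \<open>y w = 0\<close> in \<open>f'\<close> amounts to collapsing
        the non-edge \<open>{v, w}\<close> in \<open>f\<close>, which gives zero.\<close>
      have "y w dvd f'" if "w \<in> W" for w
      proof -
        have "collapse {w} l f' = collapse {v, w} l f"
          by (simp add: f'_def collapse_collapse insert_commute)
        then have "collapse {w} l f' = 0"
          using psubset.prems(2)[of v w] v that by (auto simp: W_def)
        then show ?thesis
          by (simp add: y_def dvd_iff_collapse)
      qed
      then have "(\<Prod>w\<in>W. y w) dvd f'"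
        unfolding y_def
      proof (intro prod_prime_elem_dvd prime_elem_Var_diff)
        fix w b
        assume "w \<in> W" "b \<in> W" "w \<noteq> b"
        then have "w \<noteq> l" "b \<noteq> l"
          using psubset.prems(1) by (auto simp: W_def)
        with \<open>w \<noteq> b\<close> show "\<not> (Var w - Var l :: ('n, 'k) mpoly) dvd Var b - Var l"
          by (simp add: Var_diff_dvd_Var_diff_iff doubleton_eq_iff)
      qed (use psubset.prems(1) in \<open>auto simp: W_def\<close>)
      then obtain g where g: "f' = (\<Prod>w\<in>W. y w) * g"
        by (elim dvdE)
      \<comment> \<open>Again an ideal quotient, now by the product over \<open>W\<close>: a clique
        \<open>F\<close> of neighbours of \<open>v\<close> extends to the clique
        \<open>insert v F\<close>, whose complement in \<open>N\<close> is \<open>W\<close> together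
        with \<open>M - F\<close>.\<close>
      have "g \<in> {g. (\<Prod>w\<in>W. y w) * g \<in> I}"
      proof (rule psubset.IH[of M])
        show "collapse {a, b} l g = 0" if "a \<in> M" "b \<in> M" "a \<noteq> b" "{a, b} \<notin> E" for a b
        proof -
          have "collapse {a, b} l (\<Prod>w\<in>W. y w) = (\<Prod>w\<in>W. y w)"
            unfolding collapse_hom
            using that by (intro prod.cong refl collapse_y) (auto simp: W_def M_def)
          then have "(\<Prod>w\<in>W. y w) * collapse {a, b} l g = 0"
            using f'0[of a b] that by (auto simp: g collapse_hom(2) M_def)
          moreover have "(\<Prod>w\<in>W. y w) \<noteq> 0"
            using y_nz by (auto simp: W_def)
          ultimately show ?thesis
            by simp
        qed
        show "(\<Prod>w\<in>M - F. Var w - Var l) \<in> {g. (\<Prod>w\<in>W. y w) * g \<in> I}"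
          if F: "F \<subseteq> M" "clique E F" for F
        proof -
          have "N - insert v F = W \<union> (M - F)" and "W \<inter> (M - F) = {}"
            using F v by (auto simp: W_def M_def)
          then have "(\<Prod>w\<in>N - insert v F. y w) = (\<Prod>w\<in>W. y w) * (\<Prod>w\<in>M - F. y w)"
            by (simp add: prod.union_disjoint)
          moreover have "clique E (insert v F)"
            using F by (intro clique_insert) (auto simp: M_def)
          ultimately show ?thesis
            using gen[of "insert v F"] v F by (auto simp: y_def M_def)
        qed
      next
        show "p + q \<in> {g. (\<Prod>w\<in>W. y w) * g \<in> I}"
          if "p \<in> {g. (\<Prod>w\<in>W. y w) * g \<in> I}" "q \<in> {g. (\<Prod>w\<in>W. y w) * g \<in> I}" for p q
          using that add by (simp add: distrib_left)
        show "r * p \<in> {g. (\<Prod>w\<in>W. y w) * g \<in> I}"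
          if "p \<in> {g. (\<Prod>w\<in>W. y w) * g \<in> I}" for p r
          using that scale[of "(\<Prod>w\<in>W. y w) * p" r] by (simp add: mult.left_commute)
      qed (use v psubset.prems(1) in \<open>auto simp: M_def\<close>)
      then show ?thesis
        by (simp add: g)
    qed
    ultimately have "y v * h + f' \<in> I"
      using add by simp
    then show ?thesis
      using h by (simp add: algebra_simps)
  qed
qed

subsection \<open>Clearing denominators\<close>

text \<open>Restricting the neighbours to \<open>A\<close> stands for passing to an induced
  subgraph, so \<open>E\<close> can stay fixed while vertices are removed.\<close>

definition star_prod :: "'n set set \<Rightarrow> 'n set \<Rightarrow> 'n \<Rightarrow> ('n::{finite,linorder}, 'k::field) mpoly" where
  "star_prod E A i = (\<Prod>w | w \<in> A \<and> {w, i} \<in> E. Var w - Var i)"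

text \<open>The zero coefficients outside \<open>U\<close> put the forms of all vertex sets into one
  space, where they can be compared.\<close>

definition star_form ::
    "'n set set \<Rightarrow> 'n set \<Rightarrow> ('n \<Rightarrow> ('n, 'k) mpoly) \<Rightarrow> ('n::{finite,linorder}, 'k::field) form1" where
  "star_form E U f = (\<chi> i. if i \<in> U then to_fract (f i) / to_fract (star_prod E U i) else 0)"

text \<open>
  Up to factors that do not vanish on \<open>x\<^sub>u = x\<^sub>v\<close>, compatibility says that the sum of the coefficients
  of \<open>dx\<^sub>u\<close> and \<open>dx\<^sub>v\<close> in \<^term>\<open>star_form E U f\<close> has no pole along \<open>x\<^sub>u = x\<^sub>v\<close>.
\<close>

definition compatible ::
    "'n set set \<Rightarrow> 'n set \<Rightarrow> ('n::{finite,linorder} \<Rightarrow> ('n, 'k::field) mpoly) \<Rightarrow> bool" where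
  "compatible E U f \<longleftrightarrow> (\<forall>u\<in>U. \<forall>v\<in>U. {u, v} \<in> E \<longrightarrow>
    (Var u - Var v) dvd f u * star_prod E (U - {u}) v - f v * star_prod E (U - {v}) u)"

section \<open>Factors of star products\<close>

lemma star_prod_Un:
  "A \<inter> B = {} \<Longrightarrow> star_prod E (A \<union> B) i = star_prod E A i * star_prod E B i"
  unfolding star_prod_def by (subst prod.union_disjoint[symmetric]) (auto intro: prod.cong)

lemma star_prod_diff: "B \<subseteq> A \<Longrightarrow> star_prod E A i = star_prod E B i * star_prod E (A - B) i"
  using star_prod_Un[of B "A - B" E i] by (simp add: Un_absorb1)

lemma star_prod_remove:
  assumes "v \<in> A"
  shows "(star_prod E A i :: ('n::{finite,linorder}, 'k::field) mpoly) =
    (if {v, i} \<in> E then Var v - Var i else 1) * star_prod E (A - {v}) i"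
proof -
  have "{w. w \<in> {v} \<and> {w, i} \<in> E} = (if {v, i} \<in> E then {v} else {})"
    by auto
  then have "(star_prod E {v} i :: ('n, 'k) mpoly) = (if {v, i} \<in> E then Var v - Var i else 1)"
    unfolding star_prod_def by simp
  moreover have "(star_prod E A i :: ('n, 'k) mpoly) = star_prod E {v} i * star_prod E (A - {v}) i"
    using assms by (intro star_prod_diff) simp
  ultimately show ?thesis
    by (simp only:)
qed

lemma star_prod_neq_0:
  assumes "{i} \<notin> E"
  shows "star_prod E A i \<noteq> 0"
  using assms by (auto simp: star_prod_def)

lemma star_prod_clique:
  assumes "clique E F" and "i \<in> F" and "{i} \<notin> E" and "A \<subseteq> F"
  shows "star_prod E A i = (\<Prod>w\<in>A - {i}. Var w - Var i)"
  unfolding star_prod_def using assms by (intro prod.cong) (auto simp: clique_def)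

text \<open>Under \<open>collapse {u} v\<close> a vanishing product would have a vanishing factor
  \<open>Var w - Var i\<close>, which forces \<open>{w, i} = {u, v}\<close>.\<close>

lemma not_dvd_star_prod:
  fixes E :: "('n::{finite,linorder}) set set"
  assumes "u \<noteq> v" and "{i} \<notin> E" and "\<And>w. w \<in> A \<Longrightarrow> {w, i} \<noteq> {u, v}"
  shows "\<not> (Var u - Var v) dvd (star_prod E A i :: ('n, 'k::field) mpoly)"
proof
  assume "(Var u - Var v) dvd (star_prod E A i :: ('n, 'k) mpoly)"
  then obtain w where "w \<in> A" "{w, i} \<in> E"
    and "(Var u - Var v :: ('n, 'k) mpoly) dvd Var w - Var i"
    unfolding star_prod_def dvd_iff_collapse collapse_hom(5) by auto
  then show False
    using assms by (auto simp: Var_diff_dvd_Var_diff_iff)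
qed

section \<open>The module of compatible families and its clique forms\<close>

lemma compatibleD:
  "compatible E U f \<Longrightarrow> u \<in> U \<Longrightarrow> v \<in> U \<Longrightarrow> {u, v} \<in> E \<Longrightarrow>
    (Var u - Var v) dvd f u * star_prod E (U - {u}) v - f v * star_prod E (U - {v}) u"
  unfolding compatible_def by blast

lemma compatible_add:
  assumes "compatible E U f" and "compatible E U g"
  shows "compatible E U (\<lambda>i. f i + g i)"
  unfolding compatible_def
proof (intro ballI impI)
  fix u v
  assume "u \<in> U" "v \<in> U" "{u, v} \<in> E"
  then have "(Var u - Var v) dvd
      (f u * star_prod E (U - {u}) v - f v * star_prod E (U - {v}) u) +
      (g u * star_prod E (U - {u}) v - g v * star_prod E (U - {v}) u)"
    by (intro dvd_add compatibleD assms)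
  then show "(Var u - Var v) dvd
      (f u + g u) * star_prod E (U - {u}) v - (f v + g v) * star_prod E (U - {v}) u"
    by (simp add: algebra_simps)
qed

lemma compatible_mult:
  assumes "compatible E U f"
  shows "compatible E U (\<lambda>i. r * f i)"
  unfolding compatible_def
proof (intro ballI impI)
  fix u v
  assume "u \<in> U" "v \<in> U" "{u, v} \<in> E"
  then have "(Var u - Var v) dvd
      r * (f u * star_prod E (U - {u}) v - f v * star_prod E (U - {v}) u)"
    by (intro dvd_mult compatibleD assms)
  then show "(Var u - Var v) dvd
      r * f u * star_prod E (U - {u}) v - r * f v * star_prod E (U - {v}) u"
    by (simp add: algebra_simps)
qed

lemma star_form_add: "star_form E U (\<lambda>i. f i + g i) = star_form E U f + star_form E U g"
  by (simp add: star_form_def vec_eq_iff add_divide_distrib)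

lemma star_form_mult: "star_form E U (\<lambda>i. r * f i) = poly_scale r (star_form E U f)"
  by (simp add: star_form_def poly_scale_def vec_eq_iff)

lemma to_fract_prod: "to_fract (\<Prod>w\<in>A. p w) = (\<Prod>w\<in>A. to_fract (p w))"
  by (induction A rule: infinite_finite_induct) simp_all

lemma clique_form_nth:
  "clique_form F $ i =
    (if i \<in> F then 1 / to_fract (\<Prod>w\<in>F - {i}. Var w - Var i) else 0)"
proof -
  have "clique_form F $ i = (\<Sum>u\<in>F. if u = i then
      1 / to_fract (\<Prod>w\<in>F - {i}. Var w - Var i) else 0)"
    unfolding clique_form_def sum_component
    by (intro sum.cong) (auto simp: dx_def axis_def to_fract_prod simp del: to_fract_diff)
  then show ?thesis
    by simp
qed

text \<open>For \<open>i\<close> in \<open>F\<close>, the product \<open>star_prod E U i\<close>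
  splits into the factors from \<open>F\<close>, which form the denominator in
  \<open>clique_form F\<close>, and those from \<open>U - F\<close>, which the numerator
  cancels.\<close>

lemma star_form_clique:
  assumes "clique E F" and "F \<subseteq> U" and "\<And>u. {u} \<notin> E"
  shows "star_form E U (\<lambda>i. if i \<in> F then star_prod E (U - F) i else 0) = clique_form F"
  using assms star_prod_neq_0[of _ E "U - F"]
  by (auto simp: vec_eq_iff star_form_def clique_form_nth star_prod_diff[OF assms(2)]
      star_prod_clique[of E F])

text \<open>With both ends of an edge in \<open>F\<close>, the two remaining products over
  \<open>F\<close> agree once \<open>x_u = x_v\<close>. An end outside \<open>F\<close> has value
  zero, and a nonzero value at the other end contains the factor of the edge.\<close>

lemma compatible_clique:
  fixes E :: "('n::{finite,linorder}) set set"
  assumes clique: "clique E F" and "F \<subseteq> U" and irr: "\<And>u. {u} \<notin> E"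
  shows "compatible E U (\<lambda>i. if i \<in> F then star_prod E (U - F) i else 0 :: ('n, 'k::field) mpoly)"
  unfolding compatible_def
proof (intro ballI impI)
  fix u v
  assume uv: "u \<in> U" "v \<in> U" "{u, v} \<in> E"
  then have "u \<noteq> v"
    using irr by auto
  define P where "P = (star_prod E :: _ \<Rightarrow> _ \<Rightarrow> ('n, 'k) mpoly)"
  have vu: "{v, u} \<in> E"
    using uv by (simp add: insert_commute)
  have P_remove: "P A i = (if {w, i} \<in> E then Var w - Var i else 1) * P (A - {w}) i"
    if "w \<in> A" for w i A
    using that unfolding P_def by (rule star_prod_remove)
  have dvd_P: "(Var u - Var v) dvd P (U - F) u" if "v \<notin> F"
    using that uv vu \<open>u \<noteq> v\<close> P_remove[of v "U - F" u]
    by (simp add: Var_diff_dvd_Var_diff_iff insert_commute)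
  have dvd_P': "(Var u - Var v) dvd P (U - F) v" if "u \<notin> F"
    using that uv P_remove[of u "U - F" v] by simp
  consider "u \<in> F" "v \<in> F" | "u \<notin> F" | "v \<notin> F"
    by blast
  then have "(Var u - Var v) dvd (if u \<in> F then P (U - F) u else 0) * P (U - {u}) v -
      (if v \<in> F then P (U - F) v else 0) * P (U - {v}) u"
  proof cases
    case 1
    have eq: "P (U - {a}) b = P (F - {a}) b * P (U - F) b" if "a \<in> F" for a b
    proof -
      have "U - {a} - (F - {a}) = U - F"
        using that by auto
      then show ?thesis
        using star_prod_diff[of "F - {a}" "U - {a}" E b] \<open>F \<subseteq> U\<close> by (auto simp: P_def)
    qed
    have "F - {u} - {v} = F - {u, v}" "F - {v} - {u} = F - {u, v}"
      by auto
    then have "P (F - {u}) v = (\<Prod>w\<in>F - {u, v}. Var w - Var v)"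
      "P (F - {v}) u = (\<Prod>w\<in>F - {u, v}. Var w - Var u)"
      using clique 1 irr by (simp_all add: P_def star_prod_clique[of E F])
    \<comment> \<open>Both products run over \<open>F - {u, v}\<close> and differ only in the
      subtracted variable, \<open>Var v\<close> or \<open>Var u\<close>, which the substitution
      identifies.\<close>
    then have "(Var u - Var v) dvd P (F - {u}) v - P (F - {v}) u"
      by (auto simp: dvd_diff_iff_collapse_eq collapse_hom intro!: prod.cong)
    then have "(Var u - Var v) dvd P (U - F) u * P (U - F) v * (P (F - {u}) v - P (F - {v}) u)"
      by (rule dvd_mult)
    then show ?thesis
      using 1 by (simp add: eq algebra_simps)
  qed (use dvd_P dvd_P' in auto)
  then show "(Var u - Var v) dvd
      (if u \<in> F then star_prod E (U - F) u else 0) * star_prod E (U - {u}) v -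
      (if v \<in> F then star_prod E (U - F) v else 0 :: ('n, 'k) mpoly) * star_prod E (U - {v}) u"
    by (simp only: P_def)
qed

text \<open>With \<open>f l = 0\<close>, compatibility at an edge from \<open>l\<close> to
  \<open>w\<close> involves \<open>f w\<close> alone and makes it divisible by
  \<open>Var l - Var w\<close>. This cancels the factor that \<open>l\<close> contributes to the
  denominator at \<open>w\<close>.\<close>

lemma star_form_remove:
  fixes E :: "('n::{finite,linorder}) set set" and f :: "'n \<Rightarrow> ('n, 'k::field) mpoly"
  assumes compat: "compatible E (insert l U) f" and "l \<notin> U" and "f l = 0"
    and irr: "\<And>u. {u} \<notin> E"
  obtains g where "compatible E U g" and "star_form E (insert l U) f = star_form E U g"
proof -
  \<comment> \<open>\<open>D w\<close> is the factor that the star product at \<open>w\<close> loses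
    when \<open>l\<close> is removed.\<close>
  define D :: "'n \<Rightarrow> ('n, 'k) mpoly" where
    "D w = (if {l, w} \<in> E then Var l - Var w else 1)" for w
  have D_nz: "D w \<noteq> 0" if "w \<in> U" for w
    using that \<open>l \<notin> U\<close> by (auto simp: D_def)
  have star_prod: "star_prod E (insert l A) w = D w * star_prod E A w" if "A \<subseteq> U" for A w
    using that \<open>l \<notin> U\<close> star_prod_remove[of l "insert l A" E w, where 'k = 'k]
    by (cases "l \<in> A") (auto simp: D_def)
  have "\<exists>h. f w = D w * h" if "w \<in> U" for w
  proof (cases "{l, w} \<in> E")
    case True
    have "l \<noteq> w"
      using that \<open>l \<notin> U\<close> by auto
    have "(Var l - Var w) dvd f w * star_prod E (insert l U - {w}) l"
      using compatibleD[OF compat, of l w] True that \<open>f l = 0\<close> by simp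
    moreover have "\<not> (Var l - Var w :: ('n, 'k) mpoly) dvd star_prod E (insert l U - {w}) l"
      using \<open>l \<noteq> w\<close> irr by (intro not_dvd_star_prod) (auto simp: doubleton_eq_iff)
    ultimately have "(Var l - Var w) dvd f w"
      using prime_elem_Var_diff[OF \<open>l \<noteq> w\<close>, where 'k = 'k] by (simp add: prime_elem_dvd_mult_iff)
    then show ?thesis
      using True by (auto simp: D_def elim: dvdE)
  qed (simp add: D_def)
  then obtain g where g: "f w = D w * g w" if "w \<in> U" for w
    by metis
  have "compatible E U g"
    unfolding compatible_def
  proof (intro ballI impI)
    fix u v
    assume uv: "u \<in> U" "v \<in> U" "{u, v} \<in> E"
    then have ne: "u \<noteq> v" "u \<noteq> l" "v \<noteq> l"
      using irr \<open>l \<notin> U\<close> by auto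
    then have "insert l U - {u} = insert l (U - {u})" "insert l U - {v} = insert l (U - {v})"
      by auto
    then have "(Var u - Var v) dvd f u * (D v * star_prod E (U - {u}) v) -
        f v * (D u * star_prod E (U - {v}) u)"
      using compatibleD[OF compat, of u v] uv by (simp add: star_prod)
    then have "(Var u - Var v) dvd
        D u * (D v * (g u * star_prod E (U - {u}) v - g v * star_prod E (U - {v}) u))"
      using uv by (simp add: g algebra_simps)
    moreover have "\<not> (Var u - Var v) dvd D w" if "w \<in> U" for w
      using ne that irr prime_elem_not_unit[OF prime_elem_Var_diff[OF \<open>u \<noteq> v\<close>, where 'k = 'k]]
      by (auto simp: D_def Var_diff_dvd_Var_diff_iff doubleton_eq_iff)
    ultimately show "(Var u - Var v) dvd g u * star_prod E (U - {u}) v - g v * star_prod E (U - {v}) u"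
      using uv prime_elem_Var_diff[OF \<open>u \<noteq> v\<close>, where 'k = 'k]
      by (simp add: prime_elem_dvd_mult_iff)
  qed
  moreover have "star_form E (insert l U) f = star_form E U g"
    using \<open>f l = 0\<close> \<open>l \<notin> U\<close> D_nz
    by (auto simp: star_form_def vec_eq_iff g star_prod[OF order_refl])
  ultimately show ?thesis
    using that by blast
qed

lemma star_form_in_span:
  fixes E :: "('n::{finite,linorder}) set set" and f :: "'n \<Rightarrow> ('n, 'k::field) mpoly"
  assumes "compatible E U f" and irr: "\<And>u. {u} \<notin> E"
  shows "star_form E U f \<in> module.span poly_scale {clique_form F | F. F \<noteq> {} \<and> clique E F}"
    (is "_ \<in> ?S")
  using finite[of U] assms(1)
proof (induction U arbitrary: f rule: finite_induct)
  interpret module "poly_scale :: ('n, 'k) mpoly \<Rightarrow> _"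
    by (rule module_poly_scale)
  case empty
  have "star_form E {} f = 0"
    by (simp add: star_form_def vec_eq_iff)
  then show ?case
    by (simp add: span_zero)
next
  interpret module "poly_scale :: ('n, 'k) mpoly \<Rightarrow> _"
    by (rule module_poly_scale)
  case (insert l V)
  define U where "U = insert l V"
  note compat = insert.prems[folded U_def]
  define N where "N = {w \<in> V. {w, l} \<in> E}"
  \<comment> \<open>The ideal of all values at \<open>l\<close> of compatible families whose forms
    are already in the span; it suffices that \<open>f l\<close> is one of them.\<close>
  define I where "I = {p. \<exists>g. compatible E U g \<and> g l = p \<and> star_form E U g \<in> ?S}"
  have "f l \<in> I"
  proof (rule clique_complement_ideal[of l N E])
    fix a b
    assume ab: "a \<in> N" "b \<in> N" "a \<noteq> b" "{a, b} \<notin> E"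
    then have "a \<noteq> l" "b \<noteq> l"
      using \<open>l \<notin> V\<close> by (auto simp: N_def)
    have "(Var a - Var l) dvd f a * star_prod E (U - {a}) l - f l * star_prod E (U - {l}) a"
      using ab by (intro compatibleD[OF compat]) (auto simp: N_def U_def)
    \<comment> \<open>Collapsing \<open>a\<close> uses the edge from \<open>a\<close> to
      \<open>l\<close>. Collapsing \<open>b\<close> as well kills the left side, because
      \<open>b\<close> is a neighbour of \<open>l\<close>, while the star product at
      \<open>a\<close> survives, because \<open>b\<close> is not a neighbour of \<open>a\<close>.
      Hence \<open>f l\<close> must vanish.\<close>
    then have "collapse {b} l (collapse {a} l (f a * star_prod E (U - {a}) l)) =
        collapse {b} l (collapse {a} l (f l * star_prod E (U - {l}) a))"
      by (simp add: dvd_diff_iff_collapse_eq)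
    moreover have "collapse {a, b} l (star_prod E (U - {a}) l :: ('n, 'k) mpoly) = 0"
      using ab by (auto simp: star_prod_def collapse_hom N_def U_def)
    moreover have "collapse {a, b} l (star_prod E (U - {l}) a :: ('n, 'k) mpoly) \<noteq> 0"
      using ab irr by (auto simp: star_prod_def collapse_hom insert_commute)
    ultimately show "collapse {a, b} l (f l) = 0"
      by (simp add: collapse_collapse collapse_hom(2) insert_commute)
  next
    fix p q
    assume "p \<in> I" "q \<in> I"
    then obtain g h where "compatible E U g" "g l = p" "star_form E U g \<in> ?S"
      "compatible E U h" "h l = q" "star_form E U h \<in> ?S"
      unfolding I_def by blast
    then show "p + q \<in> I"
      unfolding I_def
      by (auto intro!: exI[of _ "\<lambda>i. g i + h i"] compatible_add span_add simp: star_form_add)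
  next
    fix p r
    assume "p \<in> I"
    then obtain g where "compatible E U g" "g l = p" "star_form E U g \<in> ?S"
      unfolding I_def by blast
    then show "r * p \<in> I"
      unfolding I_def
      by (auto intro!: exI[of _ "\<lambda>i. r * g i"] compatible_mult span_scale simp: star_form_mult)
  next
    fix F
    assume F: "F \<subseteq> N" "clique E F"
    \<comment> \<open>The numerators of the form of the clique \<open>insert l F\<close>; at
      \<open>l\<close> they leave exactly the factors of the neighbours outside
      \<open>F\<close>.\<close>
    define g :: "'n \<Rightarrow> ('n, 'k) mpoly" where
      "g i = (if i \<in> insert l F then star_prod E (U - insert l F) i else 0)" for i
    have clique: "clique E (insert l F)"
      using F by (intro clique_insert) (auto simp: N_def insert_commute)
    have sub: "insert l F \<subseteq> U"
      using F by (auto simp: N_def U_def)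
    have "compatible E U g"
      unfolding g_def using clique sub irr by (rule compatible_clique)
    moreover have "star_form E U g \<in> ?S"
      unfolding g_def star_form_clique[OF clique sub irr] using clique by (intro span_base) auto
    moreover have "{w. w \<in> U - insert l F \<and> {w, l} \<in> E} = N - F"
      using \<open>l \<notin> V\<close> by (auto simp: U_def N_def)
    then have "g l = (\<Prod>w\<in>N - F. Var w - Var l)"
      by (simp add: g_def star_prod_def)
    ultimately show "(\<Prod>w\<in>N - F. Var w - Var l) \<in> I"
      unfolding I_def by auto
  qed (use \<open>l \<notin> V\<close> in \<open>simp add: N_def\<close>)
  then obtain g where g: "compatible E U g" "g l = f l" "star_form E U g \<in> ?S"
    unfolding I_def by blast
  \<comment> \<open>Since \<open>g\<close> and \<open>f\<close> agree at \<open>l\<close>, the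
    difference is zero there and descends to the vertex set \<open>V\<close>.\<close>
  have "compatible E U (\<lambda>i. f i + - 1 * g i)"
    using g compat by (intro compatible_add compatible_mult)
  then obtain h where "compatible E V h"
    and h: "star_form E U (\<lambda>i. f i + - 1 * g i) = star_form E V h"
    using star_form_remove[of E l V "\<lambda>i. f i + - 1 * g i"] \<open>l \<notin> V\<close> \<open>g l = f l\<close> irr
    unfolding U_def by auto
  then have "star_form E U (\<lambda>i. f i + - 1 * g i) \<in> ?S"
    using insert.IH by simp
  moreover have "star_form E U f = star_form E U (\<lambda>i. f i + - 1 * g i) + star_form E U g"
    unfolding star_form_add[symmetric] by simp
  ultimately show ?case
    using g unfolding U_def[symmetric] by (simp add: span_add)
qed

subsection \<open>Logarithmic forms of graphic arrangements\<close>

text \<open>Nonzero constants are units.\<close>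

lemma Const_mult_dvd_iff:
  assumes "a \<noteq> 0"
  shows "Const a * p dvd q \<longleftrightarrow> p dvd (q :: ('n, 'k::field) mpoly)"
proof
  assume "p dvd q"
  then obtain r where "q = p * r"
    by (elim dvdE)
  then have "q = Const (a * inverse a) * (p * r)"
    using assms by simp
  then have "q = Const a * p * (Const (inverse a) * r)"
    by (simp only: Const_mult ac_simps)
  then show "Const a * p dvd q"
    by (rule dvdI)
qed (rule dvd_mult_right)

lemma dvd_Const_mult_iff:
  assumes "a \<noteq> 0"
  shows "p dvd Const a * q \<longleftrightarrow> p dvd (q :: ('n, 'k::field) mpoly)"
proof
  assume "p dvd Const a * q"
  then have "p dvd Const (inverse a) * (Const a * q)"
    by (rule dvd_mult)
  then show "p dvd q"
    using assms by (simp add: mult.assoc[symmetric] Const_mult[symmetric])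
qed (rule dvd_mult)

lemma Const_neq_0: "a \<noteq> 0 \<Longrightarrow> (Const a :: ('n, 'k::field) mpoly) \<noteq> 0"
  using dvd_Const_mult_iff[of a 0 "1 :: ('n, 'k) mpoly"] by auto

lemma d_linear_nth [simp]: "d_linear c $ i = to_fract (Const (c $ i))"
proof -
  have "d_linear c $ i = (\<Sum>j\<in>UNIV. if j = i then to_fract (Const (c $ i)) else 0)"
    unfolding d_linear_def sum_component by (intro sum.cong) (auto simp: dx_def axis_def)
  then show ?thesis
    by simp
qed

text \<open>Dividing an alternating matrix by a nonzero \<open>p\<close> keeps it alternating, so
  divisibility can be tested entry by entry.\<close>

lemma wedge_d_linear_divisible_iff:
  fixes \<eta> :: "'n \<Rightarrow> ('n::{finite,linorder}, 'k::field) mpoly"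
  assumes "p \<noteq> 0"
  shows "(\<exists>\<theta>\<in>regular_forms2. wedge (\<chi> i. to_fract (\<eta> i)) (d_linear c) = scale2 (to_fract p) \<theta>) \<longleftrightarrow>
    (\<forall>i j. p dvd \<eta> i * Const (c $ j) - \<eta> j * Const (c $ i))"
proof
  assume "\<exists>\<theta>\<in>regular_forms2. wedge (\<chi> i. to_fract (\<eta> i)) (d_linear c) = scale2 (to_fract p) \<theta>"
  then obtain \<theta> where reg: "\<theta> \<in> regular_forms2"
    and \<theta>: "wedge (\<chi> i. to_fract (\<eta> i)) (d_linear c) = scale2 (to_fract p) \<theta>"
    by (rule bexE)
  show "\<forall>i j. p dvd \<eta> i * Const (c $ j) - \<eta> j * Const (c $ i)"
  proof (intro allI)
    fix i j
    have "\<theta> $ i $ j \<in> range to_fract"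
      using reg unfolding regular_forms2_def by blast
    then obtain q where "\<theta> $ i $ j = to_fract q"
      by (rule rangeE)
    then have "to_fract (\<eta> i * Const (c $ j) - \<eta> j * Const (c $ i)) = to_fract (p * q)"
      using arg_cong[OF \<theta>, of "\<lambda>\<theta>. \<theta> $ i $ j"] by (simp add: wedge_def scale2_def)
    then show "p dvd \<eta> i * Const (c $ j) - \<eta> j * Const (c $ i)"
      unfolding to_fract_eq_iff by (rule dvdI)
  qed
next
  assume "\<forall>i j. p dvd \<eta> i * Const (c $ j) - \<eta> j * Const (c $ i)"
  then obtain q where q: "\<eta> i * Const (c $ j) - \<eta> j * Const (c $ i) = p * q i j" for i j
    unfolding dvd_def by metis
  have "to_fract (q i i) = 0" for i
    using q[of i i] assms by simp
  moreover have "to_fract (q j i) = - to_fract (q i j)" for i j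
  proof -
    have "p * (q j i + q i j) =
        (\<eta> j * Const (c $ i) - \<eta> i * Const (c $ j)) + (\<eta> i * Const (c $ j) - \<eta> j * Const (c $ i))"
      by (simp only: q distrib_left)
    also have "\<dots> = 0"
      by simp
    finally have "p * (q j i + q i j) = 0" .
    then show ?thesis
      using assms by (simp add: eq_neg_iff_add_eq_0 flip: to_fract_add)
  qed
  ultimately have "(\<chi> i j. to_fract (q i j)) \<in> regular_forms2"
    unfolding regular_forms2_def mem_Collect_eq vec_lambda_beta by (intro conjI allI rangeI)
  moreover have "wedge (\<chi> i. to_fract (\<eta> i)) (d_linear c) =
      scale2 (to_fract p) (\<chi> i j. to_fract (q i j))"
    by (simp add: wedge_def scale2_def vec_eq_iff q flip: to_fract_mult to_fract_diff)
  ultimately show "\<exists>\<theta>\<in>regular_forms2.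
      wedge (\<chi> i. to_fract (\<eta> i)) (d_linear c) = scale2 (to_fract p) \<theta>"
    by (rule bexI[rotated])
qed

section \<open>Hyperplanes and linear forms of edges\<close>

definition edge_hyperplane :: "'n set \<Rightarrow> ('k::field ^ 'n::finite) set" where
  "edge_hyperplane e = {x. \<forall>i\<in>e. \<forall>j\<in>e. x $ i = x $ j}"

definition edge_poly :: "'n set \<Rightarrow> ('n::finite, 'k::field) mpoly" where
  "edge_poly e = linear_poly (form_of (edge_hyperplane e))"

lemma edge_hyperplane_doubleton: "edge_hyperplane {u, v} = {x. x $ u = x $ v}"
  by (auto simp: edge_hyperplane_def)

lemma sum_axis_mult [simp]: "(\<Sum>i\<in>UNIV. c $ i * axis j (1::'k::field) $ i) = c $ j"
  by (simp add: axis_def if_distrib[of "times _"] cong: if_cong)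

text \<open>The coefficients are read off from vectors in the hyperplane: \<open>axis i 1\<close>
  for \<open>i\<close> off the edge, and \<open>axis u 1 + axis v 1\<close>. As \<open>c\<close> is
  nonzero, its entry at \<open>u\<close> is then nonzero.\<close>

lemma is_defining_form_edge:
  fixes c :: "'k::field ^ 'n::finite"
  assumes "is_defining_form c (edge_hyperplane {u, v})" and "u \<noteq> v"
  shows "c $ u \<noteq> 0" and "c $ v = - c $ u" and "i \<noteq> u \<Longrightarrow> i \<noteq> v \<Longrightarrow> c $ i = 0"
proof -
  have mem: "x $ u = x $ v \<longleftrightarrow> (\<Sum>i\<in>UNIV. c $ i * x $ i) = 0" for x
    using assms(1) by (auto simp: is_defining_form_def edge_hyperplane_doubleton)
  show 0: "c $ i = 0" if "i \<noteq> u" "i \<noteq> v" for i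
    using mem[of "axis i 1", unfolded sum_axis_mult] that by (simp add: axis_def)
  show v: "c $ v = - c $ u"
    using mem[of "axis u 1 + axis v 1"] \<open>u \<noteq> v\<close>
    by (simp add: distrib_left sum.distrib eq_neg_iff_add_eq_0 add.commute)
      (simp add: axis_def)
  show "c $ u \<noteq> 0"
  proof
    assume "c $ u = 0"
    then have "c = 0"
      using 0 v by (metis neg_equal_0_iff_equal vec_eq_iff zero_index)
    then show False
      using assms(1) by (simp add: is_defining_form_def)
  qed
qed

lemma is_defining_form_form_of:
  assumes "u \<noteq> v"
  shows "is_defining_form (form_of (edge_hyperplane {u, v} :: ('k::field ^ 'n::finite) set))
    (edge_hyperplane {u, v})"
  unfolding form_of_def
proof (rule someI)
  have "(axis u 1 - axis v 1 :: 'k ^ 'n) $ u \<noteq> 0"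
    using assms by (simp add: axis_def)
  then have "axis u 1 - axis v 1 \<noteq> (0 :: 'k ^ 'n)"
    by (metis zero_index)
  then show "is_defining_form (axis u 1 - axis v 1 :: 'k ^ 'n) (edge_hyperplane {u, v})"
    by (auto simp: is_defining_form_def edge_hyperplane_doubleton left_diff_distrib
        sum_subtractf mult.commute[of "axis _ _ $ _"])
qed

text \<open>\<open>form_of\<close> makes an arbitrary choice, so the edge polynomial is known only
  up to a nonzero scalar \<open>a\<close>.\<close>

lemma edge_poly_doubleton:
  assumes "u \<noteq> v"
  obtains a where "a \<noteq> 0" and "edge_poly {u, v} = Const a * (Var u - Var v)"
    and "form_of (edge_hyperplane {u, v} :: ('k::field ^ 'n::finite) set) $ u = a"
    and "form_of (edge_hyperplane {u, v} :: ('k::field ^ 'n::finite) set) $ v = - a"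
    and "\<And>i. i \<noteq> u \<Longrightarrow> i \<noteq> v \<Longrightarrow>
      form_of (edge_hyperplane {u, v} :: ('k::field ^ 'n::finite) set) $ i = 0"
proof -
  define c where "c = form_of (edge_hyperplane {u, v} :: ('k ^ 'n) set)"
  note c = is_defining_form_edge[OF is_defining_form_form_of[OF assms, where 'k = 'k] assms,
      folded c_def]
  have "edge_poly {u, v} = (\<Sum>i\<in>UNIV. Const (c $ i) * Var i)"
    by (simp add: edge_poly_def linear_poly_def c_def)
  also have "\<dots> = (\<Sum>i\<in>{u, v}. Const (c $ i) * Var i)"
    by (intro sum.mono_neutral_right) (auto simp: c)
  also have "\<dots> = Const (c $ u) * (Var u - Var v)"
    using assms by (simp add: c Const_uminus algebra_simps)
  finally show ?thesis
    using c that[of "c $ u"] unfolding c_def by blast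
qed

lemma edge_poly_dvd_iff:
  assumes "u \<noteq> v"
  shows "edge_poly {u, v} dvd p \<longleftrightarrow> (Var u - Var v) dvd (p :: ('n::finite, 'k::field) mpoly)"
  using assms by (rule edge_poly_doubleton[where 'k = 'k]) (simp add: Const_mult_dvd_iff)

lemma prime_elem_edge_poly:
  assumes "u \<noteq> v"
  shows "prime_elem (edge_poly {u, v} :: ('n::{finite,linorder}, 'k::field) mpoly)"
proof (rule prime_elemI)
  show "edge_poly {u, v} \<noteq> (0 :: ('n, 'k) mpoly)"
    using assms by (rule edge_poly_doubleton[where 'k = 'k]) (use assms in \<open>simp add: Const_neq_0\<close>)
qed (use prime_elem_Var_diff[OF assms, where 'k = 'k] in
    \<open>simp_all add: edge_poly_dvd_iff[OF assms] prime_elem_dvd_mult_iff prime_elem_not_unit\<close>)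

text \<open>Used to tell the hyperplanes of different edges apart and to divide out products of edge
  polynomials by \<open>prod_prime_elem_dvd\<close>.\<close>

lemma edge_poly_dvd_edge_poly_iff:
  assumes "card e = 2" and "card e' = 2"
  shows "(edge_poly e :: ('n::{finite,linorder}, 'k::field) mpoly) dvd edge_poly e' \<longleftrightarrow> e = e'"
proof -
  obtain u v where e: "e = {u, v}" "u \<noteq> v"
    using assms(1) by (auto simp: card_2_iff)
  obtain u' v' where e': "e' = {u', v'}" "u' \<noteq> v'"
    using assms(2) by (auto simp: card_2_iff)
  obtain a where "a \<noteq> 0" "edge_poly e' = Const a * (Var u' - Var v' :: ('n, 'k) mpoly)"
    using edge_poly_doubleton[OF e'(2)] e'(1) by metis
  then show ?thesis
    using e e' by (auto simp: edge_poly_dvd_iff dvd_Const_mult_iff Var_diff_dvd_Var_diff_iff)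
qed

section \<open>From hyperplanes to edges of a simple graph\<close>

lemma simple_graph_singleton:
  assumes "simple_graph E"
  shows "{u} \<notin> E"
proof
  assume "{u} \<in> E"
  then have "card {u} = 2"
    using assms unfolding simple_graph_def by blast
  then show False
    by simp
qed

text \<open>\<open>edge_hyperplane\<close> depends only on the set \<open>e\<close>, not on an order
  of its ends, so the arrangement can be indexed by \<open>E\<close>.\<close>

lemma graphic_arrangement_eq:
  assumes "simple_graph E"
  shows "graphic_arrangement E = edge_hyperplane ` E"
proof -
  have "\<exists>u v. e = {u, v}" if "e \<in> E" for e
    using assms that unfolding simple_graph_def card_2_iff by blast
  then show ?thesis
    by (fastforce simp: graphic_arrangement_def edge_hyperplane_doubleton[symmetric])
qed

lemma defining_poly_graphic_arrangement:
  fixes E :: "('n::{finite,linorder}) set set"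
  assumes "simple_graph E"
  shows "defining_poly (graphic_arrangement E) = (\<Prod>e\<in>E. edge_poly e :: ('n, 'k::field) mpoly)"
proof -
  \<comment> \<open>Equal hyperplanes have the same chosen form, hence equal edge polynomials, and
    these divide each other only for the same edge.\<close>
  have "inj_on (edge_hyperplane :: 'n set \<Rightarrow> ('k, 'n) vec set) E"
  proof (rule inj_onI)
    fix e e'
    assume "e \<in> E" "e' \<in> E" "edge_hyperplane e = (edge_hyperplane e' :: ('k, 'n) vec set)"
    then have "card e = 2" "card e' = 2" "edge_poly e = (edge_poly e' :: ('n, 'k) mpoly)"
      using assms by (auto simp: simple_graph_def edge_poly_def)
    then show "e = e'"
      using edge_poly_dvd_edge_poly_iff[of e e', where 'k = 'k] by simp
  qed
  then show ?thesis
    by (simp add: defining_poly_def graphic_arrangement_eq[OF assms] prod.reindex edge_poly_def)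
qed

text \<open>For an edge \<open>{u, v}\<close>, wedging with a multiple of \<open>dx u - dx v\<close>
  gives entries that are, up to nonzero scalars, \<open>\<eta> i\<close> for \<open>i\<close> off
  the edge and \<open>\<eta> u + \<eta> v\<close> on it; the others vanish.\<close>

lemma log_forms1_graphic_iff:
  fixes E :: "('n::{finite,linorder}) set set" and \<omega> :: "('n, 'k::field) form1"
  assumes "simple_graph E"
  shows "\<omega> \<in> log_forms1 (graphic_arrangement E) \<longleftrightarrow>
    (\<exists>\<eta>. (\<forall>i. to_fract (\<Prod>e\<in>E. edge_poly e) * \<omega> $ i = to_fract (\<eta> i)) \<and>
      (\<forall>u v. {u, v} \<in> E \<longrightarrow>
        (\<forall>i. i \<notin> {u, v} \<longrightarrow> (Var u - Var v) dvd \<eta> i) \<and> (Var u - Var v) dvd \<eta> u + \<eta> v))"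
proof -
  define Q where "Q = (\<Prod>e\<in>E. edge_poly e :: ('n, 'k) mpoly)"
  have neq: "u \<noteq> v" if "{u, v} \<in> E" for u v
    using assms that by (auto simp: simple_graph_def)
  have edge: "\<exists>u v. e = {u, v} \<and> u \<noteq> v" if "e \<in> E" for e
    using assms that by (auto simp: simple_graph_def card_2_iff)
  have edge_all: "(\<forall>e\<in>E. X e) \<longleftrightarrow> (\<forall>u v. {u, v} \<in> E \<longrightarrow> X {u, v})" for X
    by (metis edge)
  have "edge_poly e \<noteq> (0 :: ('n, 'k) mpoly)" if "e \<in> E" for e
    using edge[OF that] prime_elem_edge_poly by (metis prime_elem_def)
  then have "Q \<noteq> 0"
    by (simp add: Q_def)
  have regular: "(\<exists>\<eta>'\<in>regular_forms1. \<omega> = (1 / to_fract Q) *s \<eta>') \<longleftrightarrow>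
      (\<exists>\<eta>. to_fract Q *s \<omega> = (\<chi> i. to_fract (\<eta> i)))"
  proof
    assume "\<exists>\<eta>'\<in>regular_forms1. \<omega> = (1 / to_fract Q) *s \<eta>'"
    then obtain \<eta>' where "\<eta>' \<in> regular_forms1" "\<omega> = (1 / to_fract Q) *s \<eta>'"
      by (rule bexE)
    moreover from this obtain \<eta> where "\<eta>' $ i = to_fract (\<eta> i)" for i
      unfolding regular_forms1_def by (auto simp: image_iff choice_iff)
    ultimately show "\<exists>\<eta>. to_fract Q *s \<omega> = (\<chi> i. to_fract (\<eta> i))"
      using \<open>Q \<noteq> 0\<close> by (auto simp: vec_eq_iff)
  next
    assume "\<exists>\<eta>. to_fract Q *s \<omega> = (\<chi> i. to_fract (\<eta> i))"
    then have "to_fract Q *s \<omega> \<in> regular_forms1"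
      by (elim exE, simp only:) (simp add: regular_forms1_def)
    then show "\<exists>\<eta>'\<in>regular_forms1. \<omega> = (1 / to_fract Q) *s \<eta>'"
      using \<open>Q \<noteq> 0\<close> by (intro bexI[of _ "to_fract Q *s \<omega>"]) (auto simp: vec_eq_iff)
  qed
  have wedge: "(\<exists>\<theta>\<in>regular_forms2. wedge (\<chi> i. to_fract (\<eta> i))
        (d_linear (form_of (edge_hyperplane {u, v} :: ('k, 'n) vec set))) =
        scale2 (to_fract (linear_poly (form_of (edge_hyperplane {u, v} :: ('k, 'n) vec set)))) \<theta>) \<longleftrightarrow>
      (\<forall>i. i \<notin> {u, v} \<longrightarrow> (Var u - Var v) dvd \<eta> i) \<and> (Var u - Var v) dvd \<eta> u + \<eta> v"
    (is "?L \<longleftrightarrow> ?R") if neq: "u \<noteq> v" for u v and \<eta> :: "'n \<Rightarrow> ('n, 'k) mpoly"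
  proof -
    define c where "c = form_of (edge_hyperplane {u, v} :: ('k, 'n) vec set)"
    define p where "p = (Var u - Var v :: ('n, 'k) mpoly)"
    obtain a where a: "a \<noteq> 0" "linear_poly c = Const a * p"
      "c $ u = a" "c $ v = - a" "\<And>i. i \<noteq> u \<Longrightarrow> i \<noteq> v \<Longrightarrow> c $ i = 0"
      using edge_poly_doubleton[OF neq, where 'k = 'k, unfolded edge_poly_def, folded c_def p_def]
      by blast
    have "p \<noteq> 0"
      using neq by (simp add: p_def)
    then have "?L \<longleftrightarrow> (\<forall>i j. p dvd \<eta> i * Const (c $ j) - \<eta> j * Const (c $ i))"
      using a(1) wedge_d_linear_divisible_iff[of "linear_poly c" \<eta> c]
      by (simp add: c_def[symmetric] a(2) Const_neq_0 Const_mult_dvd_iff)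
    also have "\<dots> \<longleftrightarrow> (\<forall>i. i \<notin> {u, v} \<longrightarrow> p dvd \<eta> i) \<and> p dvd \<eta> u + \<eta> v"
    proof (intro iffI conjI allI impI)
      assume *: "\<forall>i j. p dvd \<eta> i * Const (c $ j) - \<eta> j * Const (c $ i)"
      show "p dvd \<eta> i" if "i \<notin> {u, v}" for i
        using *[rule_format, of i u] that a
        by (simp add: mult.commute[of "\<eta> _"] dvd_Const_mult_iff)
      have "\<eta> u * Const (c $ v) - \<eta> v * Const (c $ u) = Const (- a) * (\<eta> u + \<eta> v)"
        by (simp add: a Const_uminus algebra_simps)
      then show "p dvd \<eta> u + \<eta> v"
        using *[rule_format, of u v] a(1) by (simp add: dvd_Const_mult_iff)
    next
      fix i j
      assume *: "(\<forall>i. i \<notin> {u, v} \<longrightarrow> p dvd \<eta> i) \<and> p dvd \<eta> u + \<eta> v"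
      have "\<eta> u * Const (c $ v) - \<eta> v * Const (c $ u) = Const (- a) * (\<eta> u + \<eta> v)"
        "\<eta> v * Const (c $ u) - \<eta> u * Const (c $ v) = Const a * (\<eta> u + \<eta> v)"
        by (simp_all add: a Const_uminus algebra_simps)
      then have uv: "p dvd \<eta> u * Const (c $ v) - \<eta> v * Const (c $ u)"
        "p dvd \<eta> v * Const (c $ u) - \<eta> u * Const (c $ v)"
        using * by (simp_all only: dvd_mult)
      consider "i \<notin> {u, v}" "j \<notin> {u, v}" | "i \<notin> {u, v}" "j \<in> {u, v}" | "i \<in> {u, v}" "j \<notin> {u, v}"
        | "i = j" | "i = u" "j = v" | "i = v" "j = u"
        by blast
      then show "p dvd \<eta> i * Const (c $ j) - \<eta> j * Const (c $ i)"
        by cases (use * uv in \<open>auto simp: a(5)\<close>)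
    qed
    finally show ?thesis
      by (simp add: p_def)
  qed
  \<comment> \<open>Brings the numerators \<open>\<eta>\<close> of the regularity condition to the
    front, so that the wedge condition can be stated for them.\<close>
  have ex_swap: "(\<exists>\<eta>. x = T \<eta>) \<and> Y x \<longleftrightarrow> (\<exists>\<eta>. x = T \<eta> \<and> Y (T \<eta>))"
    for x :: "('n, 'k) form1" and T :: "('n \<Rightarrow> ('n, 'k) mpoly) \<Rightarrow> ('n, 'k) form1" and Y
    by auto
  have "\<omega> \<in> log_forms1 (graphic_arrangement E) \<longleftrightarrow>
      (\<exists>\<eta>. to_fract Q *s \<omega> = (\<chi> i. to_fract (\<eta> i)) \<and>
        (\<forall>e\<in>E. \<exists>\<theta>\<in>regular_forms2. wedge (\<chi> i. to_fract (\<eta> i))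
          (d_linear (form_of (edge_hyperplane e :: ('k, 'n) vec set))) =
          scale2 (to_fract (linear_poly (form_of (edge_hyperplane e :: ('k, 'n) vec set)))) \<theta>))"
    unfolding log_forms1_def mem_Collect_eq defining_poly_graphic_arrangement[OF assms]
      Q_def[symmetric] regular unfolding graphic_arrangement_eq[OF assms] ball_simps(9)
    by (rule ex_swap[where Y = "\<lambda>\<eta>. \<forall>e\<in>E. \<exists>\<theta>\<in>regular_forms2. wedge \<eta>
      (d_linear (form_of (edge_hyperplane e :: ('k, 'n) vec set))) =
      scale2 (to_fract (linear_poly (form_of (edge_hyperplane e :: ('k, 'n) vec set)))) \<theta>"])
  also have "\<dots> \<longleftrightarrow> (\<exists>\<eta>. to_fract Q *s \<omega> = (\<chi> i. to_fract (\<eta> i)) \<and>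
      (\<forall>u v. {u, v} \<in> E \<longrightarrow>
        (\<forall>i. i \<notin> {u, v} \<longrightarrow> (Var u - Var v) dvd \<eta> i) \<and> (Var u - Var v) dvd \<eta> u + \<eta> v))"
    unfolding edge_all by (intro ex_cong1 conj_cong refl all_cong1 imp_cong wedge neq)
  finally show ?thesis
    by (simp only: Q_def vec_eq_iff vector_smult_component vec_lambda_beta)
qed

text \<open>The edges through \<open>i\<close> are the sets \<open>{w, i}\<close> for its neighbours
  \<open>w\<close>. Their polynomials give the star product up to the constant \<open>a\<close>,
  which collects the scalars chosen by \<open>form_of\<close>.\<close>

lemma prod_edge_poly_split:
  fixes E :: "('n::{finite,linorder}) set set"
  assumes "simple_graph E"
  obtains a where "a \<noteq> 0" and "(\<Prod>e\<in>E. edge_poly e :: ('n, 'k::field) mpoly) =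
    star_prod E UNIV i * (Const a * (\<Prod>e | e \<in> E \<and> i \<notin> e. edge_poly e))"
proof -
  define N where "N = {w. {w, i} \<in> E}"
  have "\<forall>w\<in>N. \<exists>a. a \<noteq> 0 \<and> edge_poly {w, i} = Const a * (Var w - Var i :: ('n, 'k) mpoly)"
  proof
    fix w
    assume "w \<in> N"
    then have "w \<noteq> i"
      using assms by (auto simp: N_def simple_graph_def)
    then show "\<exists>a. a \<noteq> 0 \<and> edge_poly {w, i} = Const a * (Var w - Var i :: ('n, 'k) mpoly)"
      by (rule edge_poly_doubleton[where 'k = 'k]) blast
  qed
  then obtain a where a: "\<And>w. w \<in> N \<Longrightarrow> a w \<noteq> 0"
    "\<And>w. w \<in> N \<Longrightarrow> edge_poly {w, i} = Const (a w) * (Var w - Var i :: ('n, 'k) mpoly)"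
    by metis
  have "{e \<in> E. i \<in> e} = (\<lambda>w. {w, i}) ` N"
  proof
    show "{e \<in> E. i \<in> e} \<subseteq> (\<lambda>w. {w, i}) ` N"
    proof
      fix e
      assume "e \<in> {e \<in> E. i \<in> e}"
      moreover from this obtain u v where "e = {u, v}"
        using assms unfolding simple_graph_def card_2_iff by blast
      ultimately have "e \<in> E" and "e = {u, i} \<or> e = {v, i}"
        by (auto simp: doubleton_eq_iff)
      then show "e \<in> (\<lambda>w. {w, i}) ` N"
        by (auto simp: N_def)
    qed
  qed (auto simp: N_def)
  moreover have "inj_on (\<lambda>w. {w, i}) N"
    by (auto simp: inj_on_def doubleton_eq_iff)
  ultimately have "(\<Prod>e | e \<in> E \<and> i \<in> e. edge_poly e :: ('n, 'k) mpoly) =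
      (\<Prod>w\<in>N. Const (a w) * (Var w - Var i))"
    by (simp add: prod.reindex a)
  also have "\<dots> = (\<Prod>w\<in>N. Const (a w)) * star_prod E UNIV i"
    by (simp add: prod.distrib star_prod_def N_def)
  also have "(\<Prod>w\<in>N. Const (a w) :: ('n, 'k) mpoly) = Const (\<Prod>w\<in>N. a w)"
    by (induction N rule: infinite_finite_induct) (simp_all add: Const_mult)
  finally have "(\<Prod>e\<in>E. edge_poly e :: ('n, 'k) mpoly) = Const (\<Prod>w\<in>N. a w) * star_prod E UNIV i *
      (\<Prod>e | e \<in> E \<and> i \<notin> e. edge_poly e)"
    by (subst prod.Int_Diff[of _ _ "{e. i \<in> e}"]) (simp_all add: Int_def set_diff_eq)
  then show ?thesis
    using that[of "\<Prod>w\<in>N. a w"] a(1) by (simp add: algebra_simps)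
qed

text \<open>The numerator of \<open>dx i\<close> over \<open>Q\<close> is divisible by the pairwise
  non-dividing primes of all edges avoiding \<open>i\<close>, hence by \<open>R i\<close>; only the
  edges at \<open>i\<close> stay in the denominator. What remains of the condition at an edge is
  compatibility.\<close>

lemma log_forms1_graphic_eq:
  fixes E :: "('n::{finite,linorder}) set set"
  assumes "simple_graph E"
  shows "(log_forms1 (graphic_arrangement E) :: ('n, 'k::field) form1 set) =
    {star_form E UNIV f | f. compatible E UNIV f}"
proof -
  define Q where "Q = (\<Prod>e\<in>E. edge_poly e :: ('n, 'k) mpoly)"
  define R where "R i = (\<Prod>e | e \<in> E \<and> i \<notin> e. edge_poly e :: ('n, 'k) mpoly)" for i
  define P where "P = (star_prod E :: _ \<Rightarrow> _ \<Rightarrow> ('n, 'k) mpoly)"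
  have card: "card e = 2" if "e \<in> E" for e
    using assms that by (simp add: simple_graph_def)
  note irr = simple_graph_singleton[OF assms]
  have "\<exists>a. a \<noteq> 0 \<and> Q = P UNIV i * (Const a * R i)" for i
    unfolding Q_def R_def P_def
    by (rule prod_edge_poly_split[OF assms, of i, where 'k = 'k]) blast
  then obtain a where a: "\<And>i. a i \<noteq> 0" and Q: "\<And>i. Q = P UNIV i * (Const (a i) * R i)"
    by metis
  have prime: "prime_elem (edge_poly e :: ('n, 'k) mpoly)" if "e \<in> E" for e
    using card[OF that] by (auto simp: card_2_iff intro: prime_elem_edge_poly)
  then have "R i \<noteq> 0" for i
    by (auto simp: R_def prime_elem_def)
  then have Q_div: "to_fract (Const (a i) * R i) / to_fract Q = 1 / to_fract (P UNIV i)" for i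
    using a by (subst Q[of i]) (simp add: Const_neq_0)
  have star_form: "\<omega> = star_form E UNIV f \<longleftrightarrow>
      (\<forall>i. to_fract Q * \<omega> $ i = to_fract (Const (a i) * R i * f i))" for \<omega> f
  proof -
    have "P UNIV i \<noteq> 0" for i
      using irr by (simp add: P_def star_prod_neq_0)
    then have "to_fract Q * \<omega> $ i = to_fract (Const (a i) * R i * f i) \<longleftrightarrow>
        \<omega> $ i = to_fract (f i) / to_fract (P UNIV i)" for i
      using a \<open>R i \<noteq> 0\<close> by (subst Q[of i]) (auto simp: Const_neq_0 field_simps)
    then show ?thesis
      by (simp add: star_form_def vec_eq_iff P_def)
  qed
  have compatible: "(Var u - Var v) dvd Const (a u) * R u * f u + Const (a v) * R v * f v \<longleftrightarrow>
      (Var u - Var v) dvd f u * P (UNIV - {u}) v - f v * P (UNIV - {v}) u"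
    if uv: "{u, v} \<in> E" for u v and f :: "'n \<Rightarrow> ('n, 'k) mpoly"
  proof -
    have "u \<noteq> v"
      using uv irr by auto
    define p where "p = (Var u - Var v :: ('n, 'k) mpoly)"
    have "prime_elem p"
      unfolding p_def using \<open>u \<noteq> v\<close> by (rule prime_elem_Var_diff)
    \<comment> \<open>The edge contributes \<open>p\<close> to the star product at \<open>v\<close>
      and \<open>- p\<close> to the one at \<open>u\<close>. Equating the two factorizations of
      \<open>Q\<close> and cancelling \<open>p\<close> relates \<open>R v\<close> to
      \<open>R u\<close>.\<close>
    have "P UNIV v = p * P (UNIV - {u}) v" "P UNIV u = - p * P (UNIV - {v}) u"
      using uv star_prod_remove[of u UNIV E v, where 'k = 'k]
        star_prod_remove[of v UNIV E u, where 'k = 'k]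
      by (simp_all add: P_def p_def insert_commute)
    then have "p * (P (UNIV - {u}) v * (Const (a v) * R v)) =
        p * (- P (UNIV - {v}) u * (Const (a u) * R u))"
      using Q[of u] Q[of v] by (simp add: algebra_simps)
    then have PR: "P (UNIV - {u}) v * (Const (a v) * R v) = - P (UNIV - {v}) u * (Const (a u) * R u)"
      using prime_elem_not_zeroI \<open>prime_elem p\<close> mult_cancel_left by blast
    \<comment> \<open>Multiplying the left condition by \<open>P (UNIV - {u}) v\<close> and removing
      the factor \<open>Const (a u) * R u\<close> gives the right one. Neither changes divisibility
      by \<open>p\<close>: the edge \<open>{u, v}\<close> occurs in neither of these
      products.\<close>
    have "P (UNIV - {u}) v * (Const (a u) * R u * f u + Const (a v) * R v * f v) =
        Const (a u) * R u * f u * P (UNIV - {u}) v + P (UNIV - {u}) v * (Const (a v) * R v) * f v"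
      by (simp add: algebra_simps)
    also have "\<dots> = Const (a u) * (R u * (f u * P (UNIV - {u}) v - f v * P (UNIV - {v}) u))"
      unfolding PR by (simp add: algebra_simps)
    finally have eq: "P (UNIV - {u}) v * (Const (a u) * R u * f u + Const (a v) * R v * f v) = \<dots>" .
    have nd_P: "\<not> p dvd P (UNIV - {u}) v"
      unfolding P_def p_def using \<open>u \<noteq> v\<close> irr
      by (intro not_dvd_star_prod) (auto simp: doubleton_eq_iff)
    have nd_R: "\<not> p dvd R u"
    proof
      assume "p dvd R u"
      then have "\<exists>e. e \<in> E \<and> u \<notin> e \<and> p dvd edge_poly e"
        unfolding R_def p_def dvd_iff_collapse collapse_hom(5) by auto
      then obtain e where "e \<in> E" "u \<notin> e" "edge_poly {u, v} dvd (edge_poly e :: ('n, 'k) mpoly)"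
        using \<open>u \<noteq> v\<close> by (auto simp: edge_poly_dvd_iff p_def)
      then show False
        using edge_poly_dvd_edge_poly_iff[of "{u, v}" e, where 'k = 'k] card uv by auto
    qed
    have "p dvd Const (a u) * R u * f u + Const (a v) * R v * f v \<longleftrightarrow>
        p dvd P (UNIV - {u}) v * (Const (a u) * R u * f u + Const (a v) * R v * f v)"
      using \<open>prime_elem p\<close> nd_P by (simp add: prime_elem_dvd_mult_iff)
    also have "\<dots> \<longleftrightarrow> p dvd f u * P (UNIV - {u}) v - f v * P (UNIV - {v}) u"
      unfolding eq dvd_Const_mult_iff[OF a] using \<open>prime_elem p\<close> nd_R
      by (simp add: prime_elem_dvd_mult_iff)
    finally show ?thesis
      by (simp add: p_def)
  qed
  show ?thesis
  proof (intro set_eqI iffI)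
    fix \<omega> :: "('n, 'k) form1"
    assume "\<omega> \<in> log_forms1 (graphic_arrangement E)"
    then obtain \<eta> where \<eta>: "\<forall>i. to_fract Q * \<omega> $ i = to_fract (\<eta> i)"
      and off: "\<And>u v i. {u, v} \<in> E \<Longrightarrow> i \<notin> {u, v} \<Longrightarrow> (Var u - Var v) dvd \<eta> i"
      and on: "\<And>u v. {u, v} \<in> E \<Longrightarrow> (Var u - Var v) dvd \<eta> u + \<eta> v"
      unfolding log_forms1_graphic_iff[OF assms] Q_def by blast
    have "Const (a i) * R i dvd \<eta> i" for i
      unfolding Const_mult_dvd_iff[OF a] R_def
    proof (rule prod_prime_elem_dvd)
      fix e
      assume e: "e \<in> {e \<in> E. i \<notin> e}"
      then obtain u v where "e = {u, v}" "u \<noteq> v"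
        using card by (force simp: card_2_iff)
      then show "edge_poly e dvd \<eta> i"
        using e off by (auto simp: edge_poly_dvd_iff)
    qed (use prime card in \<open>auto simp: edge_poly_dvd_edge_poly_iff\<close>)
    then obtain f where f: "\<eta> i = Const (a i) * R i * f i" for i
      unfolding dvd_def by metis
    have "compatible E UNIV f"
      using on compatible unfolding compatible_def f P_def by blast
    moreover have "\<omega> = star_form E UNIV f"
      using \<eta> by (simp add: star_form f)
    ultimately show "\<omega> \<in> {star_form E UNIV f | f. compatible E UNIV f}"
      by blast
  next
    fix \<omega> :: "('n, 'k) form1"
    assume "\<omega> \<in> {star_form E UNIV f | f. compatible E UNIV f}"
    then obtain f where f: "compatible E UNIV f" "\<omega> = star_form E UNIV f"
      by blast
    define \<eta> where "\<eta> i = Const (a i) * R i * f i" for i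
    have eq: "to_fract Q * \<omega> $ i = to_fract (\<eta> i)" for i
      using f(2) unfolding star_form \<eta>_def by (rule spec)
    have off: "(Var u - Var v) dvd \<eta> i" if "{u, v} \<in> E" "i \<notin> {u, v}" for u v i
    proof -
      have "edge_poly {u, v} dvd R i"
        unfolding R_def using that by (intro dvd_prodI) auto
      moreover have "u \<noteq> v"
        using that irr by auto
      ultimately show ?thesis
        by (simp add: edge_poly_dvd_iff \<eta>_def)
    qed
    have on: "(Var u - Var v) dvd \<eta> u + \<eta> v" if "{u, v} \<in> E" for u v
      unfolding \<eta>_def compatible[OF that] P_def using f(1) that by (intro compatibleD) auto
    show "\<omega> \<in> log_forms1 (graphic_arrangement E)"
      unfolding log_forms1_graphic_iff[OF assms] Q_def[symmetric]
      by (intro exI[of _ \<eta>] conjI allI impI eq off on)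
  qed
qed

theorem theorem1p4:
  fixes E :: "('n::{finite,linorder}) set set"
  assumes "simple_graph E"
  shows "module.span poly_scale {clique_form F | F. F \<noteq> {} \<and> clique E F} =
    log_forms1 (graphic_arrangement E :: ('k::field ^ 'n::{finite,linorder}) set set)"
proof -
  interpret module "poly_scale :: ('n, 'k) mpoly \<Rightarrow> _"
    by (rule module_poly_scale)
  note irr = simple_graph_singleton[OF assms]
  let ?L = "{star_form E UNIV f | f :: 'n \<Rightarrow> ('n, 'k) mpoly. compatible E UNIV f}"
  \<comment> \<open>The forms of compatible families are a submodule containing the clique forms;
    the reverse inclusion is \<open>star_form_in_span\<close>.\<close>
  have "span {clique_form F | F. F \<noteq> {} \<and> clique E F} \<subseteq> ?L"
  proof (rule span_minimal)
    show "{clique_form F | F. F \<noteq> {} \<and> clique E F} \<subseteq> ?L"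
    proof clarify
      fix F
      assume "clique E F"
      then show "\<exists>f. clique_form F = star_form E UNIV f \<and> compatible E UNIV f"
        by (intro exI[of _ "\<lambda>i. if i \<in> F then star_prod E (UNIV - F) i else 0"])
          (simp add: star_form_clique compatible_clique irr)
    qed
    show "subspace ?L"
    proof (rule subspaceI)
      have "star_form E UNIV (\<lambda>_. 0 :: ('n, 'k) mpoly) = 0"
        by (simp add: star_form_def vec_eq_iff)
      moreover have "compatible E UNIV (\<lambda>_. 0 :: ('n, 'k) mpoly)"
        by (simp add: compatible_def)
      ultimately show "0 \<in> ?L"
        by force
    next
      fix x y
      assume "x \<in> ?L" "y \<in> ?L"
      then obtain f g :: "'n \<Rightarrow> ('n, 'k) mpoly" where
        "x = star_form E UNIV f" "y = star_form E UNIV g" "compatible E UNIV f" "compatible E UNIV g"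
        by blast
      then have "x + y = star_form E UNIV (\<lambda>i. f i + g i)" "compatible E UNIV (\<lambda>i. f i + g i)"
        by (simp_all add: star_form_add compatible_add)
      then show "x + y \<in> ?L"
        by blast
    next
      fix r x
      assume "x \<in> ?L"
      then obtain f :: "'n \<Rightarrow> ('n, 'k) mpoly" where "x = star_form E UNIV f" "compatible E UNIV f"
        by blast
      then have "poly_scale r x = star_form E UNIV (\<lambda>i. r * f i)" "compatible E UNIV (\<lambda>i. r * f i)"
        by (simp_all add: star_form_mult compatible_mult)
      then show "poly_scale r x \<in> ?L"
        by blast
    qed
  qed
  moreover have "?L \<subseteq> span {clique_form F | F. F \<noteq> {} \<and> clique E F}"
    by (intro subsetI) (elim CollectE exE conjE, simp only:, intro star_form_in_span irr)
  ultimately show ?thesis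
    unfolding log_forms1_graphic_eq[OF assms] by (rule subset_antisym)
qed

end
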